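(* If a formula $F\lor G$ is derivable in $LJ^+$, and every propositional symbol occurring in both $F$ and $G$ has only positive or only negative occurrences in $F\lor G$, then either $F$ or $G$ is derivable in $LJ^+$.
   Context: Formulas are first-order formulas without function symbols and without object constants, built from propositional symbols (relation symbols of arity $0$), predicate symbols (relation symbols of arity at least $1$), the logical constants $\top,\bot$, the connectives $\&,\lor,\neg,\supset$ and the quantifiers $\forall,\exists$; quantified formulas $\forall x\,F(x)$, $\exists x\,F(x)$ are formed only from $F(x)$ in which $x$ occurs free. $\top,\bot$ are not counted as propositional or predicate symbols. A formula is propositional if it contains only propositional symbols (no predicate symbols). Positive and negative subformula occurrences in a formula $A$ are defined recursively: $A$ itself is positive; if $B\lor C$ or $B\&C$ is positive (negative), then $B$ and $C$ are positive (negative); if $\neg B$ is positive (negative), then $B$ is negative (positive); if $B\supset C$ is positive (negative), then $B$ is negative (positive) and $C$ is positive (negative); if $\forall x\,B(x)$ or $\exists x\,B(x)$ is positive (negative), then $B(x)$ is positive (negative). A sequent is $\Gamma\vdash\Lambda$ with $\Gamma$ a finite, possibly empty sequence of formulas and $\Lambda$ either a single formula or empty. The calculus $LJ$ (Gentzen's intuitionistic sequent calculus) has axioms $A\vdash A$ (any formula $A$), $\vdash\top$, $\bot\vdash$, and the following rules (premises / conclusion). Thinning: $\Gamma\vdash\Lambda\,/\,A,\Gamma\vdash\Lambda$; $\Gamma\vdash\,/\,\Gamma\vdash A$. Contraction: $A,A,\Gamma\vdash\Lambda\,/\,A,\Gamma\vdash\Lambda$. Exchange: $\Pi,A,B,\Gamma\vdash\Lambda\,/\,\Pi,B,A,\Gamma\vdash\Lambda$.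 Cut: $\Gamma\vdash C$ and $C,\Pi\vdash\Lambda\,/\,\Gamma,\Pi\vdash\Lambda$. $\&$: $\Gamma\vdash A$ and $\Gamma\vdash B\,/\,\Gamma\vdash A\&B$; $A,\Gamma\vdash\Lambda\,/\,A\&B,\Gamma\vdash\Lambda$; $B,\Gamma\vdash\Lambda\,/\,A\&B,\Gamma\vdash\Lambda$. $\lor$: $A,\Gamma\vdash\Lambda$ and $B,\Gamma\vdash\Lambda\,/\,A\lor B,\Gamma\vdash\Lambda$; $\Gamma\vdash A\,/\,\Gamma\vdash A\lor B$; $\Gamma\vdash B\,/\,\Gamma\vdash A\lor B$. $\neg$: $A,\Gamma\vdash\,/\,\Gamma\vdash\neg A$; $\Gamma\vdash A\,/\,\neg A,\Gamma\vdash$. $\supset$: $A,\Gamma\vdash B\,/\,\Gamma\vdash A\supset B$; $\Gamma\vdash A$ and $B,\Pi\vdash\Lambda\,/\,A\supset B,\Gamma,\Pi\vdash\Lambda$. $\forall$: $\Gamma\vdash F(a)\,/\,\Gamma\vdash\forall x\,F(x)$; $F(a),\Gamma\vdash\Lambda\,/\,\forall x\,F(x),\Gamma\vdash\Lambda$. $\exists$: $\Gamma\vdash F(a)\,/\,\Gamma\vdash\exists x\,F(x)$; $F(a),\Gamma\vdash\Lambda\,/\,\exists x\,F(x),\Gamma\vdash\Lambda$. Here $a$ is a variable and $F(a)$ is the result of (capture-free) substitution of $a$ for $x$ in $F(x)$; in the $\forall$-succedent and $\exists$-antecedent rules $a$ (the eigenvariable) must not occur in the conclusion. $LJ^+$ is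 $LJ$ extended with the neutralization rule: $N,\Gamma\vdash\Lambda$ and $\neg N,\Gamma\vdash\Lambda\,/\,\Gamma\vdash\Lambda$, where $N$ must be a propositional formula. A formula $A$ is derivable in a calculus if the sequent $\vdash A$ is. *)

theory Defs
  imports Main
begin

text \<open>Individual variables are de Bruijn indices, so formulas are taken up to renaming of
  bound variables: in \<open>All A\<close> and \<open>Ex A\<close> the quantified variable is index \<open>0\<close> of \<open>A\<close>, and index
  \<open>Suc n\<close> of \<open>A\<close> is index \<open>n\<close> outside. A list of variables is the argument tuple of a predicate
  symbol. \<open>props A\<close> and \<open>preds A\<close> are the propositional and predicate symbols occurring in \<open>A\<close>.\<close>

datatype (props: 'p, preds: 'r) fm =
    Truth
  | Falsity
  | Prop 'p
  | Pred 'r "nat list"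
  | Conj "('p, 'r) fm" "('p, 'r) fm"
  | Disj "('p, 'r) fm" "('p, 'r) fm"
  | Neg "('p, 'r) fm"
  | Imp "('p, 'r) fm" "('p, 'r) fm"
  | All "('p, 'r) fm"
  | Ex "('p, 'r) fm"

primrec fv :: "('p, 'r) fm \<Rightarrow> nat set" where
  "fv Truth = {}"
| "fv Falsity = {}"
| "fv (Prop p) = {}"
| "fv (Pred P xs) = set xs"
| "fv (Conj A B) = fv A \<union> fv B"
| "fv (Disj A B) = fv A \<union> fv B"
| "fv (Neg A) = fv A"
| "fv (Imp A B) = fv A \<union> fv B"
| "fv (All A) = {n. Suc n \<in> fv A}"
| "fv (Ex A) = {n. Suc n \<in> fv A}"

text \<open>Each predicate symbol is applied to as many arguments as its arity \<open>ar\<close> prescribes, and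
  there is no vacuous quantification.\<close>

primrec wf_fm :: "('r \<Rightarrow> nat) \<Rightarrow> ('p, 'r) fm \<Rightarrow> bool" where
  "wf_fm ar Truth \<longleftrightarrow> True"
| "wf_fm ar Falsity \<longleftrightarrow> True"
| "wf_fm ar (Prop p) \<longleftrightarrow> True"
| "wf_fm ar (Pred P xs) \<longleftrightarrow> length xs = ar P"
| "wf_fm ar (Conj A B) \<longleftrightarrow> wf_fm ar A \<and> wf_fm ar B"
| "wf_fm ar (Disj A B) \<longleftrightarrow> wf_fm ar A \<and> wf_fm ar B"
| "wf_fm ar (Neg A) \<longleftrightarrow> wf_fm ar A"
| "wf_fm ar (Imp A B) \<longleftrightarrow> wf_fm ar A \<and> wf_fm ar B"
| "wf_fm ar (All A) \<longleftrightarrow> wf_fm ar A \<and> 0 \<in> fv A"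
| "wf_fm ar (Ex A) \<longleftrightarrow> wf_fm ar A \<and> 0 \<in> fv A"

definition propositional :: "('p, 'r) fm \<Rightarrow> bool" where
  "propositional A \<longleftrightarrow> preds A = {}"

text \<open>As variables are the only terms, substitution is renaming of free variables. Below a
  quantifier, the renaming fixes the bound index \<open>0\<close> and acts on the shifted indices.\<close>

primrec ren :: "(nat \<Rightarrow> nat) \<Rightarrow> ('p, 'r) fm \<Rightarrow> ('p, 'r) fm" where
  "ren f Truth = Truth"
| "ren f Falsity = Falsity"
| "ren f (Prop p) = Prop p"
| "ren f (Pred P xs) = Pred P (map f xs)"
| "ren f (Conj A B) = Conj (ren f A) (ren f B)"
| "ren f (Disj A B) = Disj (ren f A) (ren f B)"
| "ren f (Neg A) = Neg (ren f A)"
| "ren f (Imp A B) = Imp (ren f A) (ren f B)"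
| "ren f (All A) = All (ren (case_nat 0 (\<lambda>n. Suc (f n))) A)"
| "ren f (Ex A) = Ex (ren (case_nat 0 (\<lambda>n. Suc (f n))) A)"

text \<open>If \<open>F\<close> is the body of a quantified formula, \<open>inst F a\<close> is \<open>F(a)\<close>.\<close>

definition inst :: "('p, 'r) fm \<Rightarrow> nat \<Rightarrow> ('p, 'r) fm" where
  "inst F a = ren (case_nat a (\<lambda>n. n)) F"

text \<open>\<open>occurs A s B\<close>: the formula \<open>B\<close> has a positive (\<open>s = True\<close>) or negative (\<open>s = False\<close>)
  subformula occurrence in \<open>A\<close>.\<close>

inductive occurs :: "('p, 'r) fm \<Rightarrow> bool \<Rightarrow> ('p, 'r) fm \<Rightarrow> bool" for A where
  self: "occurs A True A"
| conj1: "occurs A s (Conj B C) \<Longrightarrow> occurs A s B"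
| conj2: "occurs A s (Conj B C) \<Longrightarrow> occurs A s C"
| disj1: "occurs A s (Disj B C) \<Longrightarrow> occurs A s B"
| disj2: "occurs A s (Disj B C) \<Longrightarrow> occurs A s C"
| neg: "occurs A s (Neg B) \<Longrightarrow> occurs A (\<not> s) B"
| imp1: "occurs A s (Imp B C) \<Longrightarrow> occurs A (\<not> s) B"
| imp2: "occurs A s (Imp B C) \<Longrightarrow> occurs A s C"
| all: "occurs A s (All B) \<Longrightarrow> occurs A s B"
| ex: "occurs A s (Ex B) \<Longrightarrow> occurs A s B"

text \<open>\<open>LJplus ar \<Gamma> \<Lambda>\<close> is derivability of the sequent with antecedent \<open>\<Gamma>\<close> and succedent \<open>\<Lambda>\<close>,
  which is empty if it is \<open>None\<close>. The conditions \<open>wf_fm\<close> keep all sequents within the formulas of the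
  language; see \<open>LJplus_wf_fm\<close>. All rules but \<open>neutr\<close> are those of Gentzen's LJ.\<close>

inductive LJplus :: "('r \<Rightarrow> nat) \<Rightarrow> ('p, 'r) fm list \<Rightarrow> ('p, 'r) fm option \<Rightarrow> bool" for ar where
  ax: "wf_fm ar A \<Longrightarrow> LJplus ar [A] (Some A)"
| truth: "LJplus ar [] (Some Truth)"
| falsity: "LJplus ar [Falsity] None"
| thinL: "wf_fm ar A \<Longrightarrow> LJplus ar \<Gamma> \<Lambda> \<Longrightarrow> LJplus ar (A # \<Gamma>) \<Lambda>"
| thinR: "wf_fm ar A \<Longrightarrow> LJplus ar \<Gamma> None \<Longrightarrow> LJplus ar \<Gamma> (Some A)"
| contr: "LJplus ar (A # A # \<Gamma>) \<Lambda> \<Longrightarrow> LJplus ar (A # \<Gamma>) \<Lambda>"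
| exch: "LJplus ar (\<Pi> @ A # B # \<Gamma>) \<Lambda> \<Longrightarrow> LJplus ar (\<Pi> @ B # A # \<Gamma>) \<Lambda>"
| cut: "LJplus ar \<Gamma> (Some C) \<Longrightarrow> LJplus ar (C # \<Pi>) \<Lambda> \<Longrightarrow> LJplus ar (\<Gamma> @ \<Pi>) \<Lambda>"
| conjR: "LJplus ar \<Gamma> (Some A) \<Longrightarrow> LJplus ar \<Gamma> (Some B) \<Longrightarrow> LJplus ar \<Gamma> (Some (Conj A B))"
| conjL1: "wf_fm ar B \<Longrightarrow> LJplus ar (A # \<Gamma>) \<Lambda> \<Longrightarrow> LJplus ar (Conj A B # \<Gamma>) \<Lambda>"
| conjL2: "wf_fm ar A \<Longrightarrow> LJplus ar (B # \<Gamma>) \<Lambda> \<Longrightarrow> LJplus ar (Conj A B # \<Gamma>) \<Lambda>"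
| disjL: "LJplus ar (A # \<Gamma>) \<Lambda> \<Longrightarrow> LJplus ar (B # \<Gamma>) \<Lambda> \<Longrightarrow> LJplus ar (Disj A B # \<Gamma>) \<Lambda>"
| disjR1: "wf_fm ar B \<Longrightarrow> LJplus ar \<Gamma> (Some A) \<Longrightarrow> LJplus ar \<Gamma> (Some (Disj A B))"
| disjR2: "wf_fm ar A \<Longrightarrow> LJplus ar \<Gamma> (Some B) \<Longrightarrow> LJplus ar \<Gamma> (Some (Disj A B))"
| negR: "LJplus ar (A # \<Gamma>) None \<Longrightarrow> LJplus ar \<Gamma> (Some (Neg A))"
| negL: "LJplus ar \<Gamma> (Some A) \<Longrightarrow> LJplus ar (Neg A # \<Gamma>) None"
| impR: "LJplus ar (A # \<Gamma>) (Some B) \<Longrightarrow> LJplus ar \<Gamma> (Some (Imp A B))"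
| impL: "LJplus ar \<Gamma> (Some A) \<Longrightarrow> LJplus ar (B # \<Pi>) \<Lambda> \<Longrightarrow>
    LJplus ar (Imp A B # \<Gamma> @ \<Pi>) \<Lambda>"
| allR: "wf_fm ar (All F) \<Longrightarrow> a \<notin> fv (All F) \<Longrightarrow> \<forall>C \<in> set \<Gamma>. a \<notin> fv C \<Longrightarrow>
    LJplus ar \<Gamma> (Some (inst F a)) \<Longrightarrow> LJplus ar \<Gamma> (Some (All F))"
| allL: "wf_fm ar (All F) \<Longrightarrow> LJplus ar (inst F a # \<Gamma>) \<Lambda> \<Longrightarrow> LJplus ar (All F # \<Gamma>) \<Lambda>"
| exR: "wf_fm ar (Ex F) \<Longrightarrow> LJplus ar \<Gamma> (Some (inst F a)) \<Longrightarrow> LJplus ar \<Gamma> (Some (Ex F))"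
| exL: "wf_fm ar (Ex F) \<Longrightarrow> a \<notin> fv (Ex F) \<Longrightarrow> \<forall>C \<in> set \<Gamma> \<union> set_option \<Lambda>. a \<notin> fv C \<Longrightarrow>
    LJplus ar (inst F a # \<Gamma>) \<Lambda> \<Longrightarrow> LJplus ar (Ex F # \<Gamma>) \<Lambda>"
| neutr: "propositional N \<Longrightarrow> LJplus ar (N # \<Gamma>) \<Lambda> \<Longrightarrow> LJplus ar (Neg N # \<Gamma>) \<Lambda> \<Longrightarrow> LJplus ar \<Gamma> \<Lambda>"

lemma LJplus_wf_fm:
  assumes "LJplus ar \<Gamma> \<Lambda>"
  shows "\<forall>A \<in> set \<Gamma> \<union> set_option \<Lambda>. wf_fm ar A"
  using assms by induction auto

definition derivable :: "('r \<Rightarrow> nat) \<Rightarrow> ('p, 'r) fm \<Rightarrow> bool" where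
  "derivable ar A \<longleftrightarrow> LJplus ar [] (Some A)"

end

theory Submission
  imports Defs
begin

text \<open>Neutralization makes the propositional symbols classical. So a formula \<open>A\<close> is derivable as soon
  as it follows, for every truth assignment \<open>v\<close>, from the literals that \<open>v\<close> makes true
  (\<open>derivable_if_all_literals\<close>), and given these literals, \<open>A\<close> is interchangeable with \<open>psub v A\<close>,
  the result of replacing each propositional symbol by its truth value
  (\<open>psub_replacement\<close>). Being underivable is therefore witnessed by an assignment.

  For a fixed assignment the disjunction property holds outright: if \<open>Disj F G\<close> is derivable, then
  so is \<open>psub v F\<close> or \<open>psub v G\<close> (\<open>derivable_psub_Disj\<close>). The reason is that, once propositional
  symbols are replaced by truth values, every neutralized formula \<open>N\<close> is either derivable or
  refutable. Kleene's slash, a predicate on formulas that implies derivability and treats disjunction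
  and existence constructively, is then preserved by all the rules, cut and neutralization
  included; no cut elimination is needed.

  Now suppose that neither \<open>F\<close> nor \<open>G\<close> is derivable, and take assignments \<open>vF\<close> and \<open>vG\<close> that
  witness this. They may disagree on symbols common to \<open>F\<close> and \<open>G\<close>. However, passing from \<open>vF\<close>
  to an assignment that makes positively occurring symbols less true and negatively occurring
  symbols more true only makes \<open>F\<close> harder to derive. As every common symbol has occurrences of
  one sign only, setting it to false if they are positive and to true if they are negative gives a
  single assignment for which both \<open>psub w F\<close> and \<open>psub w G\<close> are underivable, against the
  disjunction property.\<close>

section \<open>Renaming of variables\<close>

lemma finite_fv: "finite (fv A)"
proof (induction A)
  case (All A)
  then show ?case using finite_vimageI[of "fv A" Suc] by (simp add: vimage_def)
next
  case (Ex A)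
  then show ?case using finite_vimageI[of "fv A" Suc] by (simp add: vimage_def)
qed auto

lemma ren_cong: "(\<And>n. n \<in> fv A \<Longrightarrow> f n = g n) \<Longrightarrow> ren f A = ren g A"
proof (induction A arbitrary: f g)
  case (All A)
  show ?case by (auto intro!: All.IH All.prems split: nat.split)
next
  case (Ex A)
  show ?case by (auto intro!: Ex.IH Ex.prems split: nat.split)
next
  case (Conj A B)
  show ?case by (auto intro!: Conj.IH Conj.prems)
next
  case (Disj A B)
  show ?case by (auto intro!: Disj.IH Disj.prems)
next
  case (Imp A B)
  show ?case by (auto intro!: Imp.IH Imp.prems)
next
  case (Neg A)
  show ?case by (auto intro!: Neg.IH Neg.prems)
qed auto

lemma case_nat_0_Suc: "case_nat 0 (\<lambda>n. Suc n) = (\<lambda>n. n)"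
  by (auto split: nat.split)

lemma ren_id: "ren (\<lambda>n. n) A = A"
  by (induction A) (simp_all add: case_nat_0_Suc)

lemma ren_closed: "fv A = {} \<Longrightarrow> ren f A = A"
  using ren_cong[of A f "\<lambda>n. n"] by (simp add: ren_id)

lemma case_nat_comp: "case_nat b h (case_nat 0 (\<lambda>n. Suc (g n)) n) = case_nat b (\<lambda>n. h (g n)) n"
  by (simp split: nat.split)

lemma ren_ren: "ren f (ren g A) = ren (\<lambda>n. f (g n)) A"
  by (induction A arbitrary: f g) (simp_all add: case_nat_comp)

lemma ren_inst: "ren f (inst A a) = ren (case_nat (f a) f) A"
  unfolding inst_def ren_ren by (rule ren_cong) (simp split: nat.split)

lemma inst_ren: "inst (ren (case_nat 0 (\<lambda>n. Suc (f n))) A) b = ren (case_nat b f) A"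
  unfolding inst_def ren_ren by (rule ren_cong) (simp split: nat.split)

lemma Suc_vimage_lift:
  "{n. Suc n \<in> case_nat 0 (\<lambda>n. Suc (f n)) ` S} = f ` {n. Suc n \<in> S}"
proof (rule set_eqI)
  fix m
  have "Suc m = case_nat 0 (\<lambda>n. Suc (f n)) k \<longleftrightarrow> (\<exists>n. k = Suc n \<and> m = f n)" for k
    by (cases k) auto
  then show "m \<in> {n. Suc n \<in> case_nat 0 (\<lambda>n. Suc (f n)) ` S} \<longleftrightarrow> m \<in> f ` {n. Suc n \<in> S}"
    by (auto simp: image_iff)
qed

lemma zero_in_lift_image: "0 \<in> S \<Longrightarrow> 0 \<in> case_nat 0 f ` S"
  by (rule image_eqI[where x = 0]) auto

lemma fv_ren: "fv (ren f A) = f ` fv A"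
  by (induction A arbitrary: f) (simp_all add: Suc_vimage_lift image_Un)

lemma wf_fm_ren: "wf_fm ar A \<Longrightarrow> wf_fm ar (ren f A)"
  by (induction A arbitrary: f) (simp_all add: fv_ren zero_in_lift_image)

lemma fresh_var:
  assumes "finite S"
  obtains a where "a \<notin> fv A" "a \<notin> S" "\<And>C. C \<in> set \<Gamma> \<Longrightarrow> a \<notin> fv C"
proof -
  have fin: "finite (fv A \<union> S \<union> (\<Union>C\<in>set \<Gamma>. fv C))" using assms by (simp add: finite_fv)
  then obtain a where "a \<notin> fv A \<union> S \<union> (\<Union>C\<in>set \<Gamma>. fv C)"
    using ex_new_if_finite[OF infinite_UNIV_nat fin] by (elim exE)
  then show ?thesis by (intro that) auto
qed

lemma map_ren_upd: "\<forall>C\<in>set \<Gamma>. a \<notin> fv C \<Longrightarrow> map (ren (f(a := b))) \<Gamma> = map (ren f) \<Gamma>"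
  by (auto intro!: ren_cong)

lemma map_option_ren_upd:
  "\<forall>C\<in>set_option \<Lambda>. a \<notin> fv C \<Longrightarrow> map_option (ren (f(a := b))) \<Lambda> = map_option (ren f) \<Lambda>"
  by (cases \<Lambda>) (auto intro!: ren_cong)

lemma ren_upd_inst:
  "a \<notin> fv (All A) \<Longrightarrow> ren (f(a := b)) (inst A a) = inst (ren (case_nat 0 (\<lambda>n. Suc (f n))) A) b"
  unfolding ren_inst inst_ren by (rule ren_cong) (auto split: nat.split)

text \<open>The renaming need not be injective and may identify an eigenvariable with a variable of the
  conclusion. So in the eigenvariable cases the induction hypothesis is applied to \<open>f(a := b)\<close>,
  which agrees with \<open>f\<close> on the conclusion and sends the eigenvariable \<open>a\<close> to a fresh \<open>b\<close>.\<close>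

lemma LJplus_ren:
  "LJplus ar \<Gamma> \<Lambda> \<Longrightarrow> LJplus ar (map (ren f) \<Gamma>) (map_option (ren f) \<Lambda>)"
proof (induction arbitrary: f rule: LJplus.induct)
  case (allR A a \<Gamma>)
  obtain b where b: "b \<notin> fv (ren f (All A))" "\<And>C. C \<in> set (map (ren f) \<Gamma>) \<Longrightarrow> b \<notin> fv C"
    using fresh_var[of "{}" "ren f (All A)" "map (ren f) \<Gamma>"] by blast
  have "LJplus ar (map (ren f) \<Gamma>) (Some (inst (ren (case_nat 0 (\<lambda>n. Suc (f n))) A) b))"
    using allR.IH[of "f(a := b)"] allR.hyps map_ren_upd[of \<Gamma> a f b] ren_upd_inst[of a A f b]
    by (simp del: fun_upd_apply)
  then show ?case
    using b wf_fm_ren[OF allR.hyps(1), of f] by (auto intro!: LJplus.allR[where a = b])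
next
  case (exL A a \<Gamma> \<Lambda>)
  obtain b where b: "b \<notin> fv (ren f (Ex A))" "b \<notin> (\<Union>C\<in>set_option (map_option (ren f) \<Lambda>). fv C)"
      "\<And>C. C \<in> set (map (ren f) \<Gamma>) \<Longrightarrow> b \<notin> fv C"
    using fresh_var[of "\<Union>C\<in>set_option (map_option (ren f) \<Lambda>). fv C" "ren f (Ex A)"
        "map (ren f) \<Gamma>"] by (auto simp: finite_fv)
  have "LJplus ar (inst (ren (case_nat 0 (\<lambda>n. Suc (f n))) A) b # map (ren f) \<Gamma>)
      (map_option (ren f) \<Lambda>)"
    using exL.IH[of "f(a := b)"] exL.hyps map_ren_upd[of \<Gamma> a f b]
      map_option_ren_upd[of \<Lambda> a f b] ren_upd_inst[of a A f b]
    by (simp del: fun_upd_apply)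
  then show ?case
    using b wf_fm_ren[OF exL.hyps(1), of f] by (auto intro!: LJplus.exL[where a = b])
next
  case (allL A a \<Gamma> \<Lambda>)
  then show ?case using wf_fm_ren[OF allL.hyps(1), of f]
    by (auto intro!: LJplus.allL[where a = "f a"] simp: ren_inst inst_ren)
next
  case (exR A \<Gamma> a)
  then show ?case using wf_fm_ren[OF exR.hyps(1), of f]
    by (auto intro!: LJplus.exR[where a = "f a"] simp: ren_inst inst_ren)
next
  case (neutr N \<Gamma> \<Lambda>)
  have "propositional (ren f M)" if "propositional M" for M :: "('b, 'a) fm"
    using that unfolding propositional_def by (induction M arbitrary: f) auto
  then show ?case using neutr LJplus.neutr[of "ren f N"] by simp
next
  case (cut \<Gamma> C \<Pi> \<Lambda>)
  then show ?case by (auto intro: LJplus.cut[where C = "ren f C"])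
next
  case (contr A \<Gamma> \<Lambda>)
  then show ?case using LJplus.contr[of ar "ren f A"] by simp
next
  case (exch \<Pi> A B \<Gamma> \<Lambda>)
  then show ?case using LJplus.exch[of ar "map (ren f) \<Pi>" "ren f A" "ren f B"] by simp
next
  case thinL
  then show ?case by (simp add: LJplus.thinL wf_fm_ren)
next
  case thinR
  then show ?case by (simp add: LJplus.thinR wf_fm_ren)
next
  case conjR
  then show ?case by (simp add: LJplus.conjR)
next
  case conjL1
  then show ?case by (simp add: LJplus.conjL1 wf_fm_ren)
next
  case conjL2
  then show ?case by (simp add: LJplus.conjL2 wf_fm_ren)
next
  case disjL
  then show ?case by (simp add: LJplus.disjL)
next
  case disjR1
  then show ?case by (simp add: LJplus.disjR1 wf_fm_ren)
next
  case disjR2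
  then show ?case by (simp add: LJplus.disjR2 wf_fm_ren)
next
  case negR
  then show ?case by (simp add: LJplus.negR)
next
  case negL
  then show ?case by (simp add: LJplus.negL)
next
  case impR
  then show ?case by (simp add: LJplus.impR)
next
  case impL
  then show ?case by (simp add: LJplus.impL)
qed (simp_all add: LJplus.ax LJplus.truth LJplus.falsity wf_fm_ren)

section \<open>Structural rules\<close>

lemma LJplus_exch_right:
  "LJplus ar (\<Pi> @ A # \<Delta> @ \<Gamma>) \<Lambda> \<Longrightarrow> LJplus ar (\<Pi> @ \<Delta> @ A # \<Gamma>) \<Lambda>"
proof (induction \<Delta> arbitrary: \<Pi>)
  case (Cons B \<Delta>)
  then show ?case using LJplus.exch[of ar \<Pi> A B "\<Delta> @ \<Gamma>" \<Lambda>] Cons.IH[of "\<Pi> @ [B]"] by simp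
qed simp

lemma LJplus_exch_left:
  "LJplus ar (\<Pi> @ \<Delta> @ A # \<Gamma>) \<Lambda> \<Longrightarrow> LJplus ar (\<Pi> @ A # \<Delta> @ \<Gamma>) \<Lambda>"
proof (induction \<Delta> arbitrary: \<Pi>)
  case (Cons B \<Delta>)
  then show ?case using LJplus.exch[of ar \<Pi> B A "\<Delta> @ \<Gamma>" \<Lambda>] Cons.IH[of "\<Pi> @ [B]"] by simp
qed simp

lemma LJplus_absorb:
  "LJplus ar (\<Gamma> @ \<Delta>) \<Lambda> \<Longrightarrow> set \<Gamma> \<subseteq> set \<Delta> \<Longrightarrow> LJplus ar \<Delta> \<Lambda>"
proof (induction \<Gamma>)
  case (Cons A \<Gamma>)
  then obtain D1 D2 where D: "\<Delta> = D1 @ A # D2" by (auto simp: in_set_conv_decomp)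
  have "LJplus ar ([A] @ A # (\<Gamma> @ D1) @ D2) \<Lambda>"
    using Cons.prems(1) unfolding D by (intro LJplus_exch_left) simp
  then have "LJplus ar ([] @ A # (\<Gamma> @ D1) @ D2) \<Lambda>" using LJplus.contr by simp
  then have "LJplus ar ([] @ (\<Gamma> @ D1) @ A # D2) \<Lambda>" by (rule LJplus_exch_right)
  then show ?case using Cons unfolding D by simp
qed simp

lemma LJplus_rotate: "LJplus ar (\<Delta> @ \<Gamma>) \<Lambda> \<Longrightarrow> LJplus ar (\<Gamma> @ \<Delta>) \<Lambda>"
proof (induction \<Delta> arbitrary: \<Gamma>)
  case (Cons A \<Delta>)
  have "LJplus ar ([] @ (\<Delta> @ \<Gamma>) @ A # []) \<Lambda>"
    using Cons.prems by (intro LJplus_exch_right) simp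
  then show ?case using Cons.IH[of "\<Gamma> @ [A]"] by simp
qed simp

lemma LJplus_thins:
  "LJplus ar \<Gamma> \<Lambda> \<Longrightarrow> \<forall>A\<in>set \<Delta>. wf_fm ar A \<Longrightarrow> LJplus ar (\<Delta> @ \<Gamma>) \<Lambda>"
  by (induction \<Delta>) (auto intro: LJplus.thinL)

text \<open>Antecedents may be treated as sets, so that no order or multiplicity of hypotheses has to be
  tracked from here on.\<close>

lemma LJplus_mono:
  "LJplus ar \<Gamma> \<Lambda> \<Longrightarrow> set \<Gamma> \<subseteq> set \<Delta> \<Longrightarrow> \<forall>A\<in>set \<Delta>. wf_fm ar A \<Longrightarrow> LJplus ar \<Delta> \<Lambda>"
  by (rule LJplus_absorb[OF LJplus_rotate[OF LJplus_thins]])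

lemma LJplus_wf_ante: "LJplus ar \<Gamma> \<Lambda> \<Longrightarrow> A \<in> set \<Gamma> \<Longrightarrow> wf_fm ar A"
  using LJplus_wf_fm by blast

lemma LJplus_wf_succ: "LJplus ar \<Gamma> (Some A) \<Longrightarrow> wf_fm ar A"
  using LJplus_wf_fm by fastforce

lemma derivable_wf: "derivable ar A \<Longrightarrow> wf_fm ar A"
  unfolding derivable_def by (rule LJplus_wf_succ)

lemma LJplus_assm:
  "A \<in> set \<Gamma> \<Longrightarrow> \<forall>C\<in>set \<Gamma>. wf_fm ar C \<Longrightarrow> LJplus ar \<Gamma> (Some A)"
  by (rule LJplus_mono[OF LJplus.ax]) auto

lemma LJplus_discharge:
  "LJplus ar \<Gamma> \<Lambda> \<Longrightarrow> \<forall>C\<in>set \<Gamma>. derivable ar C \<Longrightarrow> LJplus ar [] \<Lambda>"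
proof (induction \<Gamma>)
  case (Cons C \<Gamma>)
  then show ?case using LJplus.cut[of ar "[]" C \<Gamma> \<Lambda>] by (simp add: derivable_def)
qed simp

lemma LJplus_contradiction:
  assumes "wf_fm ar A"
  shows "LJplus ar [Neg A, A] None"
  using LJplus.negL[OF LJplus.ax[OF assms]] .

lemma derivable_Falsity_iff:
  "derivable ar (Falsity :: ('p, 'r) fm) \<longleftrightarrow> LJplus ar ([] :: ('p, 'r) fm list) None"
  unfolding derivable_def
  using LJplus.cut[of ar "[]" Falsity "[]" None] LJplus.falsity LJplus.thinR[of ar Falsity "[]"]
  by auto

lemma derivable_ex_falso:
  fixes A :: "('p, 'r) fm"
  shows "derivable ar (Falsity :: ('p, 'r) fm) \<Longrightarrow> wf_fm ar A \<Longrightarrow> derivable ar A"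
  using LJplus.thinR unfolding derivable_Falsity_iff by (auto simp: derivable_def)

section \<open>Replacing propositional symbols by truth values\<close>

primrec psub :: "('p \<Rightarrow> bool) \<Rightarrow> ('p, 'r) fm \<Rightarrow> ('p, 'r) fm" where
  "psub v Truth = Truth"
| "psub v Falsity = Falsity"
| "psub v (Prop p) = (if v p then Truth else Falsity)"
| "psub v (Pred P xs) = Pred P xs"
| "psub v (Conj A B) = Conj (psub v A) (psub v B)"
| "psub v (Disj A B) = Disj (psub v A) (psub v B)"
| "psub v (Neg A) = Neg (psub v A)"
| "psub v (Imp A B) = Imp (psub v A) (psub v B)"
| "psub v (All A) = All (psub v A)"
| "psub v (Ex A) = Ex (psub v A)"

lemma fv_psub [simp]: "fv (psub v A) = fv A"
  by (induction A) auto

lemma wf_fm_psub [simp]: "wf_fm ar (psub v A) = wf_fm ar A"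
  by (induction A) auto

lemma preds_psub: "preds (psub v A) = preds A"
  by (induction A) auto

lemma psub_ren: "psub v (ren f A) = ren f (psub v A)"
  by (induction A arbitrary: f) auto

lemma psub_inst: "psub v (inst A a) = inst (psub v A) a"
  by (simp add: inst_def psub_ren)

text \<open>A neutralized formula remains propositional because truth values are no predicate symbols, and
  eigenvariable conditions survive because truth values contain no variables.\<close>

lemma LJplus_psub:
  "LJplus ar \<Gamma> \<Lambda> \<Longrightarrow> LJplus ar (map (psub v) \<Gamma>) (map_option (psub v) \<Lambda>)"
proof (induction rule: LJplus.induct)
  case (neutr N \<Gamma> \<Lambda>)
  then show ?case using LJplus.neutr[of "psub v N"] by (simp add: propositional_def preds_psub)
next
  case (cut \<Gamma> C \<Pi> \<Lambda>)
  then show ?case by (auto intro: LJplus.cut[where C = "psub v C"])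
next
  case (allR A a \<Gamma>)
  then show ?case by (auto intro!: LJplus.allR[where a = a] simp: psub_inst)
next
  case (exL A a \<Gamma> \<Lambda>)
  then show ?case by (cases \<Lambda>) (auto intro!: LJplus.exL[where a = a] simp: psub_inst)
next
  case (allL A a \<Gamma> \<Lambda>)
  then show ?case by (auto intro!: LJplus.allL[where a = a] simp: psub_inst)
next
  case (exR A \<Gamma> a)
  then show ?case by (auto intro!: LJplus.exR[where a = a] simp: psub_inst)
next
  case (contr A \<Gamma> \<Lambda>)
  then show ?case using LJplus.contr[of ar "psub v A"] by simp
next
  case (exch \<Pi> A B \<Gamma> \<Lambda>)
  then show ?case using LJplus.exch[of ar "map (psub v) \<Pi>" "psub v A" "psub v B"] by simp
next
  case thinL
  then show ?case by (simp add: LJplus.thinL)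
next
  case thinR
  then show ?case by (simp add: LJplus.thinR)
next
  case conjR
  then show ?case by (simp add: LJplus.conjR)
next
  case conjL1
  then show ?case by (simp add: LJplus.conjL1)
next
  case conjL2
  then show ?case by (simp add: LJplus.conjL2)
next
  case disjL
  then show ?case by (simp add: LJplus.disjL)
next
  case disjR1
  then show ?case by (simp add: LJplus.disjR1)
next
  case disjR2
  then show ?case by (simp add: LJplus.disjR2)
next
  case negR
  then show ?case by (simp add: LJplus.negR)
next
  case negL
  then show ?case by (simp add: LJplus.negL)
next
  case impR
  then show ?case by (simp add: LJplus.impR)
next
  case impL
  then show ?case by (simp add: LJplus.impL)
qed (simp_all add: LJplus.ax LJplus.truth LJplus.falsity)

section \<open>The slash\<close>

text \<open>Aczel's form of the Kleene slash with empty hypothesis set, for the formula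
  \<open>ren f (psub v A)\<close>. Keeping the variable assignment \<open>f\<close> and the truth assignment \<open>v\<close> as parameters,
  instead of applying them to the formula, makes the recursion structural. Negation and implication
  demand derivability in addition to the constructive clause, since otherwise
  the slash of these formulas would not imply that they are derivable. Underivability of
  \<open>Falsity\<close> is not presupposed: its slash is its derivability, and if it is derivable everything
  is slashed (\<open>slash_ex_falso\<close>).\<close>

primrec slash :: "('r \<Rightarrow> nat) \<Rightarrow> ('p \<Rightarrow> bool) \<Rightarrow> (nat \<Rightarrow> nat) \<Rightarrow> ('p, 'r) fm \<Rightarrow> bool" where
  "slash ar v f Truth \<longleftrightarrow> True"
| "slash ar v f Falsity \<longleftrightarrow> derivable ar (Falsity :: ('p, 'r) fm)"
| "slash ar v f (Prop p) \<longleftrightarrow> derivable ar (psub v (Prop p) :: ('p, 'r) fm)"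
| "slash ar v f (Pred P xs) \<longleftrightarrow> derivable ar (Pred P (map f xs) :: ('p, 'r) fm)"
| "slash ar v f (Conj A B) \<longleftrightarrow> slash ar v f A \<and> slash ar v f B"
| "slash ar v f (Disj A B) \<longleftrightarrow> slash ar v f A \<or> slash ar v f B"
| "slash ar v f (Neg A) \<longleftrightarrow> derivable ar (ren f (psub v (Neg A))) \<and>
    (slash ar v f A \<longrightarrow> derivable ar (Falsity :: ('p, 'r) fm))"
| "slash ar v f (Imp A B) \<longleftrightarrow> derivable ar (ren f (psub v (Imp A B))) \<and>
    (slash ar v f A \<longrightarrow> slash ar v f B)"
| "slash ar v f (All A) \<longleftrightarrow> derivable ar (ren f (psub v (All A))) \<and>
    (\<forall>a. slash ar v (case_nat a f) A)"
| "slash ar v f (Ex A) \<longleftrightarrow> (\<exists>a. slash ar v (case_nat a f) A)"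

lemma slash_cong:
  "(\<And>n. n \<in> fv A \<Longrightarrow> f n = g n) \<Longrightarrow> slash ar v f A = slash ar v g A"
proof (induction A arbitrary: f g)
  case (All A)
  have "slash ar v (case_nat a f) A = slash ar v (case_nat a g) A" for a
    by (rule All.IH) (auto intro: All.prems split: nat.split)
  moreover have "ren f (psub v (All A)) = ren g (psub v (All A))"
    by (rule ren_cong, rule All.prems) simp
  ultimately show ?case by (simp del: ren.simps psub.simps)
next
  case (Ex A)
  have "slash ar v (case_nat a f) A = slash ar v (case_nat a g) A" for a
    by (rule Ex.IH) (auto intro: Ex.prems split: nat.split)
  then show ?case by simp
next
  case (Neg A)
  have "ren f (psub v (Neg A)) = ren g (psub v (Neg A))"
    by (rule ren_cong, rule Neg.prems) simp
  then show ?case using Neg.IH[of f g] Neg.prems by (simp del: ren.simps psub.simps)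
next
  case (Imp A B)
  have "ren f (psub v (Imp A B)) = ren g (psub v (Imp A B))"
    by (rule ren_cong, rule Imp.prems) simp
  then show ?case using Imp.IH[of f g] Imp.prems by (simp del: ren.simps psub.simps)
next
  case (Conj A B)
  show ?case using Conj.IH[of f g] Conj.prems by simp
next
  case (Disj A B)
  show ?case using Disj.IH[of f g] Disj.prems by simp
next
  case (Pred P xs)
  then have "map f xs = map g xs" by simp
  then show ?case by (simp only: slash.simps)
qed auto

lemma slash_ren: "slash ar v f (ren g A) = slash ar v (\<lambda>n. f (g n)) A"
proof (induction A arbitrary: f g)
  case (Pred P xs)
  then show ?case by (simp add: comp_def)
qed (simp_all add: psub_ren ren_ren case_nat_comp)

lemma slash_inst: "slash ar v f (inst A a) = slash ar v (case_nat (f a) f) A"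
  unfolding inst_def slash_ren by (rule slash_cong) (simp split: nat.split)

lemma slash_upd_inst:
  "a \<notin> fv (All A) \<Longrightarrow> slash ar v (f(a := b)) (inst A a) = slash ar v (case_nat b f) A"
  unfolding slash_inst by (rule slash_cong) (auto split: nat.split)

lemma derivable_if_slash:
  "slash ar v f A \<Longrightarrow> wf_fm ar A \<Longrightarrow> derivable ar (ren f (psub v A))"
proof (induction A arbitrary: f)
  case Truth
  then show ?case by (simp add: derivable_def LJplus.truth)
next
  case (Prop p)
  then show ?case by (auto split: if_splits)
next
  case (Conj A B)
  then show ?case by (simp add: derivable_def LJplus.conjR)
next
  case (Disj A B)
  then show ?case by (auto simp: derivable_def wf_fm_ren intro: LJplus.disjR1 LJplus.disjR2)
next
  case (Ex A)
  then obtain a where "slash ar v (case_nat a f) A" by auto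
  then have "derivable ar (inst (ren (case_nat 0 (\<lambda>n. Suc (f n))) (psub v A)) a)"
    using Ex.IH Ex.prems(2) by (simp add: inst_ren)
  moreover have "wf_fm ar (ren f (psub v (Ex A)))"
    using Ex.prems(2) by (intro wf_fm_ren) simp
  ultimately show ?case by (auto simp: derivable_def intro: LJplus.exR)
qed (auto simp del: ren.simps(7-9) psub.simps(7-9))

lemma slash_ex_falso:
  fixes A :: "('p, 'r) fm"
  assumes "derivable ar (Falsity :: ('p, 'r) fm)"
  shows "wf_fm ar A \<Longrightarrow> slash ar v f A"
proof (induction A arbitrary: f)
  case (Neg A)
  have "wf_fm ar (ren f (psub v (Neg A)))" using Neg by (intro wf_fm_ren) simp
  then show ?case using derivable_ex_falso[OF assms] assms by simp
next
  case (Imp A B)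
  have "wf_fm ar (ren f (psub v (Imp A B)))" using Imp by (intro wf_fm_ren) simp
  then show ?case using derivable_ex_falso[OF assms] Imp by simp
next
  case (All A)
  have "wf_fm ar (ren f (psub v (All A)))" using All by (intro wf_fm_ren) simp
  then show ?case using derivable_ex_falso[OF assms] All by simp
qed (use assms in \<open>auto intro!: derivable_ex_falso[OF assms]\<close>)

text \<open>This supplies the derivability that the clauses for \<open>Neg\<close>, \<open>Imp\<close> and \<open>All\<close> of the slash
  demand: as slashed hypotheses are derivable, they can be cut away.\<close>

lemma LJplus_subst_discharge:
  assumes "LJplus ar \<Gamma> \<Lambda>" "\<forall>C\<in>set \<Gamma>. slash ar v f C"
  shows "LJplus ar [] (map_option (\<lambda>A. ren f (psub v A)) \<Lambda>)"
proof (rule LJplus_discharge)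
  show "LJplus ar (map (ren f) (map (psub v) \<Gamma>)) (map_option (\<lambda>A. ren f (psub v A)) \<Lambda>)"
    using LJplus_ren[OF LJplus_psub[OF assms(1)], of f v]
    by (simp add: option.map_comp comp_def)
  show "\<forall>C\<in>set (map (ren f) (map (psub v) \<Gamma>)). derivable ar C"
    using assms(2) by (auto intro: derivable_if_slash LJplus_wf_ante[OF assms(1)])
qed

lemma derivable_NegI: "LJplus ar [A] None \<Longrightarrow> derivable ar (Neg A)"
  by (simp add: derivable_def LJplus.negR)

lemma derivable_ImpI: "LJplus ar [A] (Some B) \<Longrightarrow> derivable ar (Imp A B)"
  by (simp add: derivable_def LJplus.impR)

lemma derivable_Truth: "derivable ar Truth"
  by (simp add: derivable_def LJplus.truth)

lemma derivable_Neg_Falsity: "derivable ar (Neg Falsity)"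
  by (rule derivable_NegI[OF LJplus.falsity])

lemma LJplus_None_if_Neg: "derivable ar (Neg A) \<Longrightarrow> LJplus ar [A] None"
  using LJplus.cut[of ar "[]" "Neg A" "[A]" None] LJplus_contradiction[of ar A]
    derivable_wf[of ar "Neg A"] by (simp add: derivable_def)

text \<open>This is what makes neutralization sound for the slash. It rests on \<open>psub v\<close> having
  turned the propositional symbols into \<open>Truth\<close> and \<open>Falsity\<close>, which are decided. Quantifiers do not
  arise: a propositional formula has no variables, and vacuous quantification is excluded.\<close>

lemma slash_propositional:
  fixes N :: "('p, 'r) fm"
  assumes "propositional N" "wf_fm ar N"
  shows "slash ar v f N \<or> slash ar v f (Neg N)"
  using assms
proof (induction N)
  case Falsity
  then show ?case by (simp add: derivable_Neg_Falsity)
next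
  case (Prop p)
  then show ?case by (simp add: derivable_Truth derivable_Neg_Falsity)
next
  case (Pred P xs)
  then show ?case by (simp add: propositional_def)
next
  case (Conj A B)
  let ?A = "ren f (psub v A)" and ?B = "ren f (psub v B)"
  have w: "wf_fm ar ?A" "wf_fm ar ?B" using Conj.prems by (auto intro: wf_fm_ren)
  have "derivable ar (Neg (Conj ?A ?B))" if "derivable ar (Neg ?A)"
    using LJplus.conjL1[OF w(2) LJplus_None_if_Neg[OF that]] by (rule derivable_NegI)
  moreover have "derivable ar (Neg (Conj ?A ?B))" if "derivable ar (Neg ?B)"
    using LJplus.conjL2[OF w(1) LJplus_None_if_Neg[OF that]] by (rule derivable_NegI)
  ultimately show ?case using Conj by (auto simp: propositional_def)
next
  case (Disj A B)
  let ?A = "ren f (psub v A)" and ?B = "ren f (psub v B)"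
  have "derivable ar (Neg (Disj ?A ?B))" if "derivable ar (Neg ?A)" "derivable ar (Neg ?B)"
    using LJplus.disjL[OF that[THEN LJplus_None_if_Neg]] by (rule derivable_NegI)
  then show ?case using Disj by (auto simp: propositional_def)
next
  case (Neg A)
  have "derivable ar (Neg (Neg (ren f (psub v A))))" if "slash ar v f A"
  proof -
    have "derivable ar (ren f (psub v A))" using that Neg.prems by (auto intro: derivable_if_slash)
    then show ?thesis by (auto simp: derivable_def intro: derivable_NegI[unfolded derivable_def] LJplus.negL)
  qed
  then show ?case using Neg by (auto simp: propositional_def)
next
  case (Imp A B)
  let ?A = "ren f (psub v A)" and ?B = "ren f (psub v B)"
  have w: "wf_fm ar A" "wf_fm ar B" "wf_fm ar ?A" "wf_fm ar ?B"
    using Imp.prems by (auto intro: wf_fm_ren)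
  have IH: "slash ar v f A \<or> slash ar v f (Neg A)" "slash ar v f B \<or> slash ar v f (Neg B)"
    using Imp by (auto simp: propositional_def)
  consider "slash ar v f B" | "slash ar v f (Neg A)" | "slash ar v f A" "slash ar v f (Neg B)"
    using IH by blast
  then show ?case
  proof cases
    case 1
    then have "derivable ar ?B" using w by (intro derivable_if_slash)
    then have "derivable ar (Imp ?A ?B)"
      using w by (intro derivable_ImpI LJplus.thinL) (auto simp: derivable_def)
    then show ?thesis using 1 by simp
  next
    case 2
    then have "derivable ar (Neg ?A)" by simp
    then have "derivable ar (Imp ?A ?B)"
      using w by (intro derivable_ImpI LJplus.thinR LJplus_None_if_Neg)
    then show ?thesis using 2 slash_ex_falso w by auto
  next
    case 3
    then have A: "LJplus ar [] (Some ?A)" using w derivable_if_slash by (auto simp: derivable_def)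
    have B: "LJplus ar [?B] None" using 3 by (auto intro: LJplus_None_if_Neg)
    have "derivable ar (Neg (Imp ?A ?B))"
      using LJplus.impL[OF A B] by (auto intro: derivable_NegI)
    then show ?thesis using 3 by simp
  qed
next
  case (All A)
  have "fv A = {}" if "propositional A" using that unfolding propositional_def by (induction A) auto
  then show ?case using All by (auto simp: propositional_def)
next
  case (Ex A)
  have "fv A = {}" if "propositional A" using that unfolding propositional_def by (induction A) auto
  then show ?case using Ex by (auto simp: propositional_def)
qed auto

text \<open>Quantification over all \<open>f\<close> in the induction serves the eigenvariable rules: the premise is used
  with the eigenvariable \<open>a\<close> assigned an arbitrary variable (\<open>allR\<close>) or the witness (\<open>exL\<close>), which
  changes nothing in the conclusion. An empty succedent counts as \<open>Falsity\<close>.\<close>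

lemma slash_sound:
  fixes \<Gamma> :: "('p, 'r) fm list"
  assumes "LJplus ar \<Gamma> \<Lambda>" "\<forall>C\<in>set \<Gamma>. slash ar v f C"
  shows "case \<Lambda> of None \<Rightarrow> derivable ar (Falsity :: ('p, 'r) fm) | Some A \<Rightarrow> slash ar v f A"
  using assms
proof (induction arbitrary: f rule: LJplus.induct)
  case (thinR A \<Gamma>)
  then show ?case by (auto intro: slash_ex_falso)
next
  case (disjL A \<Gamma> \<Lambda> B)
  then show ?case by auto
next
  case (cut \<Gamma> C \<Pi> \<Lambda>)
  have "slash ar v f C" using cut.IH(1)[of f] cut.prems by simp
  then show ?case using cut.IH(2)[of f] cut.prems by auto
next
  case (negR A \<Gamma>)
  have "derivable ar (ren f (psub v (Neg A)))"
    using LJplus_subst_discharge[OF LJplus.negR[OF negR.hyps] negR.prems] by (simp add: derivable_def)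
  then show ?case using negR.IH[of f] negR.prems by simp
next
  case (impR A \<Gamma> B)
  have "derivable ar (ren f (psub v (Imp A B)))"
    using LJplus_subst_discharge[OF LJplus.impR[OF impR.hyps] impR.prems] by (simp add: derivable_def)
  then show ?case using impR.IH[of f] impR.prems by simp
next
  case (impL \<Gamma> A B \<Pi> \<Lambda>)
  have "slash ar v f A" using impL.IH(1)[of f] impL.prems by simp
  then show ?case using impL.IH(2)[of f] impL.prems by auto
next
  case (allR A a \<Gamma>)
  have "derivable ar (ren f (psub v (All A)))"
    using LJplus_subst_discharge[OF LJplus.allR[OF allR.hyps] allR.prems] by (simp add: derivable_def)
  moreover have "slash ar v (case_nat b f) A" for b
  proof -
    have "\<forall>C\<in>set \<Gamma>. slash ar v (f(a := b)) C"
    proof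
      fix C assume C: "C \<in> set \<Gamma>"
      then have "slash ar v (f(a := b)) C = slash ar v f C"
        using allR.hyps(3) by (intro slash_cong) auto
      then show "slash ar v (f(a := b)) C" using C allR.prems by simp
    qed
    then show ?thesis using allR.IH[of "f(a := b)"] slash_upd_inst[OF allR.hyps(2)]
      by (simp del: fun_upd_apply)
  qed
  ultimately show ?case by simp
next
  case (exL A a \<Gamma> \<Lambda>)
  then obtain b where b: "slash ar v (case_nat b f) A" by auto
  have *: "slash ar v (f(a := b)) C = slash ar v f C" if "C \<in> set \<Gamma> \<union> set_option \<Lambda>" for C
    using exL.hyps(3) that by (intro slash_cong) auto
  have "slash ar v (f(a := b)) (inst A a)"
    using b slash_upd_inst[of a A] exL.hyps(2) by (simp del: fun_upd_apply)
  then show ?case using exL.IH[of "f(a := b)"] exL.prems *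
    by (auto split: option.splits simp del: fun_upd_apply)
next
  case (neutr N \<Gamma> \<Lambda>)
  have "slash ar v f N \<or> slash ar v f (Neg N)"
    using slash_propositional[OF neutr.hyps(1)] LJplus_wf_ante[OF neutr.hyps(2)] by simp
  then show ?case
    using neutr.IH(1)[of f] neutr.IH(2)[of f] neutr.prems by (auto simp del: slash.simps)
qed (auto simp: slash_inst)

lemma derivable_psub_Disj:
  assumes "derivable ar (Disj F G)"
  shows "derivable ar (psub v F) \<or> derivable ar (psub v G)"
proof -
  have "slash ar v (\<lambda>n. n) (Disj F G)"
    using slash_sound[of ar "[]" "Some (Disj F G)" v "\<lambda>n. n"] assms by (simp add: derivable_def)
  then show ?thesis
    using derivable_if_slash[of ar v "\<lambda>n. n"] derivable_wf[OF assms] by (auto simp: ren_id)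
qed

section \<open>Underivability witnessed by truth assignments\<close>

text \<open>Hypotheses without free variables are fixed by any renaming, hence do not restrict the choice of
  the eigenvariable. This is why derivability relative to them passes under quantifiers.\<close>

lemma LJplus_All_mono:
  assumes "LJplus ar (A # \<Gamma>) (Some B)" "wf_fm ar (All A)" "wf_fm ar (All B)"
    and closed: "\<forall>C\<in>set \<Gamma>. fv C = {}"
  shows "LJplus ar (All A # \<Gamma>) (Some (All B))"
proof -
  obtain a where a: "a \<notin> fv (All B)" "\<And>C. C \<in> set (All A # \<Gamma>) \<Longrightarrow> a \<notin> fv C"
    using fresh_var[of "{}" "All B" "All A # \<Gamma>"] by blast
  have "LJplus ar (inst A a # \<Gamma>) (Some (inst B a))"
    using LJplus_ren[OF assms(1), of "case_nat a (\<lambda>n. n)"] closed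
    by (simp add: inst_def map_idI ren_closed)
  then show ?thesis
    using a assms by (intro LJplus.allR[where a = a] LJplus.allL[where a = a]) auto
qed

lemma LJplus_Ex_mono:
  assumes "LJplus ar (A # \<Gamma>) (Some B)" "wf_fm ar (Ex A)" "wf_fm ar (Ex B)"
    and closed: "\<forall>C\<in>set \<Gamma>. fv C = {}"
  shows "LJplus ar (Ex A # \<Gamma>) (Some (Ex B))"
proof -
  obtain a where a: "a \<notin> fv (Ex B)" "\<And>C. C \<in> set (Ex A # \<Gamma>) \<Longrightarrow> a \<notin> fv C"
    using fresh_var[of "{}" "Ex B" "Ex A # \<Gamma>"] by blast
  have "LJplus ar (inst A a # \<Gamma>) (Some (inst B a))"
    using LJplus_ren[OF assms(1), of "case_nat a (\<lambda>n. n)"] closed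
    by (simp add: inst_def map_idI ren_closed)
  then show ?thesis
    using a a(2)[of "Ex A"] assms by (intro LJplus.exL[where a = a] LJplus.exR[where a = a]) auto
qed

lemma LJplus_Conj_mono:
  assumes "LJplus ar (A # \<Gamma>) (Some A')" "LJplus ar (B # \<Gamma>) (Some B')"
  shows "LJplus ar (Conj A B # \<Gamma>) (Some (Conj A' B'))"
  using assms LJplus_wf_ante[OF assms(1)] LJplus_wf_ante[OF assms(2)]
  by (intro LJplus.conjR LJplus.conjL1 LJplus.conjL2) auto

lemma LJplus_Disj_mono:
  assumes "LJplus ar (A # \<Gamma>) (Some A')" "LJplus ar (B # \<Gamma>) (Some B')"
  shows "LJplus ar (Disj A B # \<Gamma>) (Some (Disj A' B'))"
  using assms LJplus_wf_succ[OF assms(1)] LJplus_wf_succ[OF assms(2)]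
  by (intro LJplus.disjL LJplus.disjR1[OF _ assms(1)] LJplus.disjR2[OF _ assms(2)]) auto

lemma LJplus_Neg_mono:
  assumes "LJplus ar (A # \<Gamma>) (Some A')"
  shows "LJplus ar (Neg A' # \<Gamma>) (Some (Neg A))"
proof (rule LJplus.negR)
  show "LJplus ar (A # Neg A' # \<Gamma>) None"
    by (rule LJplus_mono[OF LJplus.negL[OF assms]])
      (use LJplus_wf_ante[OF assms] LJplus_wf_succ[OF assms] in auto)
qed

lemma LJplus_Imp_mono:
  assumes "LJplus ar (A # \<Gamma>) (Some A')" "LJplus ar (B' # \<Gamma>) (Some B)"
  shows "LJplus ar (Imp A' B' # \<Gamma>) (Some (Imp A B))"
proof (rule LJplus.impR)
  show "LJplus ar (A # Imp A' B' # \<Gamma>) (Some B)"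
    by (rule LJplus_mono[OF LJplus.impL[OF assms]])
      (use LJplus_wf_ante[OF assms(1)] LJplus_wf_ante[OF assms(2)] LJplus_wf_succ[OF assms(1)] in auto)
qed

text \<open>Deriving \<open>A\<close> from \<open>psub v A\<close> needs only half of the equivalence between \<open>p\<close> and its truth value
  at each occurrence: at a positive one \<open>p\<close> must follow if it was replaced by \<open>Truth\<close>, at
  a negative one \<open>Neg p\<close> must follow if it was replaced by \<open>Falsity\<close>. Hence \<open>\<Gamma>\<close> may be the literals of
  an assignment that differs from \<open>v\<close>. Subformulas are carried with their sign in the fixed formula
  \<open>R\<close>; at negative ones the derivation runs in the opposite direction.\<close>

lemma psub_replacement:
  fixes R A :: "('p, 'r) fm"
  assumes pos: "\<And>p. occurs R True (Prop p) \<Longrightarrow> v p \<Longrightarrow> Prop p \<in> set \<Gamma>"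
    and neg: "\<And>p. occurs R False (Prop p) \<Longrightarrow> \<not> v p \<Longrightarrow> Neg (Prop p) \<in> set \<Gamma>"
    and closed: "\<forall>C\<in>set \<Gamma>. fv C = {}" and wf: "\<forall>C\<in>set \<Gamma>. wf_fm ar C"
  shows "occurs R s A \<Longrightarrow> wf_fm ar A \<Longrightarrow>
    (if s then LJplus ar (psub v A # \<Gamma>) (Some A) else LJplus ar (A # \<Gamma>) (Some (psub v A)))"
proof (induction A arbitrary: s)
  case Truth
  then show ?case using wf by (auto intro!: LJplus_assm)
next
  case Falsity
  then show ?case using wf by (auto intro!: LJplus_assm)
next
  case (Pred P xs)
  then show ?case using wf by (auto intro!: LJplus_assm)
next
  case (Prop p)
  have F: "LJplus ar (Falsity # \<Gamma>) (Some (Prop p))"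
    using wf by (intro LJplus_mono[OF LJplus.thinR[OF _ LJplus.falsity]]) auto
  have T: "LJplus ar (Prop p # \<Gamma>) (Some Truth)"
    using wf by (intro LJplus_mono[OF LJplus.truth]) auto
  have N: "LJplus ar (Prop p # \<Gamma>) (Some Falsity)" if "Neg (Prop p) \<in> set \<Gamma>"
    by (rule LJplus_mono[OF LJplus.thinR[OF _ LJplus_contradiction[of ar "Prop p"]]])
      (use that wf in auto)
  have P: "LJplus ar (Truth # \<Gamma>) (Some (Prop p))" if "Prop p \<in> set \<Gamma>"
    using that wf by (intro LJplus_assm) auto
  show ?case
    using Prop pos[of p] neg[of p] F T N P by (cases s; cases "v p") auto
next
  case (Conj A B)
  have "occurs R s A" "occurs R s B" using Conj.prems occurs.conj1 occurs.conj2 by blast+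
  then show ?case using Conj.IH[of s] Conj.prems by (cases s) (auto intro: LJplus_Conj_mono)
next
  case (Disj A B)
  have "occurs R s A" "occurs R s B" using Disj.prems occurs.disj1 occurs.disj2 by blast+
  then show ?case using Disj.IH[of s] Disj.prems by (cases s) (auto intro: LJplus_Disj_mono)
next
  case (Neg A)
  have "occurs R (\<not> s) A" using Neg.prems occurs.neg by blast
  then show ?case using Neg.IH[of "\<not> s"] Neg.prems by (cases s) (auto intro: LJplus_Neg_mono)
next
  case (Imp A B)
  have "occurs R (\<not> s) A" "occurs R s B" using Imp.prems occurs.imp1 occurs.imp2 by blast+
  then show ?case using Imp.IH(1)[of "\<not> s"] Imp.IH(2)[of s] Imp.prems
    by (cases s) (auto intro: LJplus_Imp_mono)
next
  case (All A)
  have "occurs R s A" using All.prems occurs.all by blast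
  then show ?case using All.IH[of s] All.prems closed
    by (cases s) (auto intro!: LJplus_All_mono)
next
  case (Ex A)
  have "occurs R s A" using Ex.prems occurs.ex by blast
  then show ?case using Ex.IH[of s] Ex.prems closed
    by (cases s) (auto intro!: LJplus_Ex_mono)
qed

text \<open>Each symbol is eliminated by neutralization, applied to the two assignments that differ only
  there.\<close>

lemma derivable_if_all_literals:
  fixes ps :: "'p list" and A :: "('p, 'r) fm"
  assumes "distinct ps"
    and "\<And>v. LJplus ar (map (\<lambda>p. if v p then Prop p else Neg (Prop p)) ps) (Some A)"
  shows "derivable ar A"
  using assms
proof (induction ps)
  case Nil
  then show ?case by (simp add: derivable_def)
next
  case (Cons p ps)
  let ?lits = "\<lambda>v. map (\<lambda>p. if v p then Prop p else Neg (Prop p)) ps :: ('p, 'r) fm list"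
  have "LJplus ar (?lits v) (Some A)" for v
  proof (rule LJplus.neutr[of "Prop p"])
    have eq: "?lits (v(p := b)) = ?lits v" for b
      using Cons.prems(1) by (auto intro!: map_cong)
    show "LJplus ar (Prop p # ?lits v) (Some A)"
      using Cons.prems(2)[of "v(p := True)"] unfolding list.map eq by simp
    show "LJplus ar (Neg (Prop p) # ?lits v) (Some A)"
      using Cons.prems(2)[of "v(p := False)"] unfolding list.map eq by simp
  qed (simp add: propositional_def)
  then show ?case using Cons by simp
qed

lemma occurs_props: "occurs A s B \<Longrightarrow> props B \<subseteq> props A"
  by (induction rule: occurs.induct) auto

lemma finite_props: "finite (props A)"
  by (induction A) auto

text \<open>The witness \<open>v\<close> is an assignment whose literals on \<open>props A\<close> do not entail \<open>A\<close>. It serves every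
  \<open>w\<close> on the appropriate side of it, since by \<open>psub_replacement\<close> the literals of \<open>v\<close> together with
  \<open>psub w A\<close> do entail \<open>A\<close>.\<close>

lemma refuting_assignment:
  assumes "wf_fm ar A" "\<not> derivable ar A"
  shows "\<exists>v. \<forall>w. (\<forall>p. occurs A True (Prop p) \<longrightarrow> w p \<longrightarrow> v p) \<longrightarrow>
    (\<forall>p. occurs A False (Prop p) \<longrightarrow> v p \<longrightarrow> w p) \<longrightarrow> \<not> derivable ar (psub w A)"
proof -
  obtain ps where ps: "set ps = props A" "distinct ps"
    using finite_distinct_list[OF finite_props[of A]] by (elim exE conjE)
  obtain v where v: "\<not> LJplus ar (map (\<lambda>p. if v p then Prop p else Neg (Prop p)) ps) (Some A)"
    using derivable_if_all_literals[OF ps(2), of ar A] assms(2) by metis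
  let ?\<Gamma> = "map (\<lambda>p. if v p then Prop p else Neg (Prop p)) ps"
  have "\<not> derivable ar (psub w A)"
    if up: "\<forall>p. occurs A True (Prop p) \<longrightarrow> w p \<longrightarrow> v p"
      and down: "\<forall>p. occurs A False (Prop p) \<longrightarrow> v p \<longrightarrow> w p" for w
  proof
    assume "derivable ar (psub w A)"
    then have d: "LJplus ar [] (Some (psub w A))" by (simp add: derivable_def)
    have mem: "p \<in> set ps" if "occurs A s (Prop p)" for p s
      using occurs_props[OF that] ps(1) by auto
    have "if True then LJplus ar (psub w A # ?\<Gamma>) (Some A) else LJplus ar (A # ?\<Gamma>) (Some (psub w A))"
    proof (rule psub_replacement[of A])
      show "Prop p \<in> set ?\<Gamma>" if "occurs A True (Prop p)" "w p" for p
        using mem[OF that(1)] up that by (auto simp: image_iff)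
      show "Neg (Prop p) \<in> set ?\<Gamma>" if "occurs A False (Prop p)" "\<not> w p" for p
        using mem[OF that(1)] down that by (auto simp: image_iff)
    qed (auto intro: occurs.self assms(1))
    then show False using LJplus.cut[OF d, of ?\<Gamma> "Some A"] v by simp
  qed
  then show ?thesis by (intro exI[of _ v] allI impI)
qed

lemma occurs_Disj1: "occurs F s A \<Longrightarrow> occurs (Disj F G) s A"
  by (induction rule: occurs.induct) (blast intro: occurs.intros)+

lemma occurs_Disj2: "occurs G s A \<Longrightarrow> occurs (Disj F G) s A"
  by (induction rule: occurs.induct) (blast intro: occurs.intros)+

theorem mainTheorem15:
  fixes ar :: "'r \<Rightarrow> nat" and F G :: "('p, 'r) fm"
  assumes "\<And>P. 1 \<le> ar P"
    and "derivable ar (Disj F G)"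
    and "\<And>p. p \<in> props F \<Longrightarrow> p \<in> props G \<Longrightarrow>
      (\<forall>s. occurs (Disj F G) s (Prop p) \<longrightarrow> s) \<or> (\<forall>s. occurs (Disj F G) s (Prop p) \<longrightarrow> \<not> s)"
  shows "derivable ar F \<or> derivable ar G"
proof (rule ccontr)
  assume "\<not> (derivable ar F \<or> derivable ar G)"
  then have nF: "\<not> derivable ar F" and nG: "\<not> derivable ar G" by auto
  have wf: "wf_fm ar F" "wf_fm ar G" using derivable_wf[OF assms(2)] by auto
  obtain vF where vF: "\<forall>w. (\<forall>p. occurs F True (Prop p) \<longrightarrow> w p \<longrightarrow> vF p) \<longrightarrow>
      (\<forall>p. occurs F False (Prop p) \<longrightarrow> vF p \<longrightarrow> w p) \<longrightarrow> \<not> derivable ar (psub w F)"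
    using refuting_assignment[OF wf(1) nF] by (elim exE)
  obtain vG where vG: "\<forall>w. (\<forall>p. occurs G True (Prop p) \<longrightarrow> w p \<longrightarrow> vG p) \<longrightarrow>
      (\<forall>p. occurs G False (Prop p) \<longrightarrow> vG p \<longrightarrow> w p) \<longrightarrow> \<not> derivable ar (psub w G)"
    using refuting_assignment[OF wf(2) nG] by (elim exE)
  \<comment> \<open>A common symbol becomes false if it occurs only positively and true if it occurs only
    negatively: the choice that favours the derivability of neither disjunct.\<close>
  define w where "w p = (if p \<in> props F \<and> p \<in> props G then occurs (Disj F G) False (Prop p)
      else if p \<in> props F then vF p else vG p)" for p
  have one: "\<not> (occurs (Disj F G) True (Prop p) \<and> occurs (Disj F G) False (Prop p))"
    if "p \<in> props F" "p \<in> props G" for p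
    using assms(3)[OF that] by blast
  have "\<not> derivable ar (psub w F)"
  proof (rule vF[rule_format])
    fix p assume o: "occurs F True (Prop p)" "w p"
    have "p \<in> props F" using occurs_props[OF o(1)] by simp
    then show "vF p" using o(2) one[of p] occurs_Disj1[OF o(1)] by (auto simp: w_def split: if_splits)
  next
    fix p assume o: "occurs F False (Prop p)" "vF p"
    have "p \<in> props F" using occurs_props[OF o(1)] by simp
    then show "w p" using o(2) occurs_Disj1[OF o(1)] by (auto simp: w_def)
  qed
  moreover have "\<not> derivable ar (psub w G)"
  proof (rule vG[rule_format])
    fix p assume o: "occurs G True (Prop p)" "w p"
    have "p \<in> props G" using occurs_props[OF o(1)] by simp
    then show "vG p" using o(2) one[of p] occurs_Disj2[OF o(1)] by (auto simp: w_def split: if_splits)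
  next
    fix p assume o: "occurs G False (Prop p)" "vG p"
    have "p \<in> props G" using occurs_props[OF o(1)] by simp
    then show "w p" using o(2) occurs_Disj2[OF o(1)] by (auto simp: w_def)
  qed
  ultimately show False using derivable_psub_Disj[OF assms(2), of w] by blast
qed

end
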